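(* Assume $1\le n<\omega$ and (a) $\bar\lambda=\langle\lambda_\ell:\ell<n\rangle$ and $\bar\lambda^i=\langle\lambda_{\ell,i}:\ell<n\rangle$ for $i<\delta$; (b) $I$ is an ideal on $\delta$; (c) $\lambda_\ell=\mathrm{tcf}\big(\prod_{i<\delta}\lambda_{\ell,i}/I\big)$ for $\ell<n$; (d) $\bar f^\ell=\langle f_{\ell,\alpha}:\alpha<\lambda_\ell\rangle$ is $<_I$-increasing and cofinal in $\prod_{i<\delta}\lambda_{\ell,i}$, for $\ell<n$; (e) $\delta<\lambda_{\ell,i}=\mathrm{cf}(\lambda_{\ell,i})$; (f) for $\bar\alpha\in\prod_{\ell<n}\lambda_\ell$, $f_{\bar\alpha}$ is the function on $\delta$ given by $f_{\bar\alpha}(i)=\langle f_{\ell,\alpha_\ell}(i):\ell<n\rangle\in\prod_{\ell<n}\lambda_{\ell,i}$. Then for any $X\in(J^{\mathrm{bd}}_{\bar\lambda})^+$ we have $$\big\{i<\delta:\{f_{\bar\alpha}(i):\bar\alpha\in X\}\in J^{\mathrm{bd}}_{\bar\lambda^i}\big\}\in I.$$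
   Context: Ideals are proper and closed under subsets and finite unions; $J^+=\{A\subseteq\mathrm{Dom}(J):A\notin J\}$. For a regular cardinal $\lambda$, $J^{\mathrm{bd}}_\lambda$ is the ideal of bounded subsets of $\lambda$. For a finite sequence $\bar\lambda=\langle\lambda_\ell:\ell<n\rangle$ of regular cardinals, $J^{\mathrm{bd}}_{\bar\lambda}$ is the ideal on $\prod_{\ell<n}\lambda_\ell$ such that $X\in(J^{\mathrm{bd}}_{\bar\lambda})^+$ iff for unboundedly many $x_0<\lambda_0$, for unboundedly many $x_1<\lambda_1$, ..., for unboundedly many $x_{n-1}<\lambda_{n-1}$, $\langle x_0,\dots,x_{n-1}\rangle\in X$ (no monotonicity of $\bar\lambda$ is assumed). For $f,g$ functions on $\delta$ to ordinals, $f<_Ig$ means $\{i<\delta:f(i)\ge g(i)\}\in I$. $\mathrm{tcf}(P)=\lambda$ means $P$ has an increasing cofinal sequence of length $\lambda$ ($\lambda$ regular). *)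

theory Defs
  imports Main "HOL-Library.FuncSet"
begin

text \<open>
  Ordinals are well-order relations in the sense of the BNF cardinal library: the ordinals below
  \<open>r\<close> are the elements of \<open>Field r\<close>, and for those \<open>x < y\<close> reads \<open>(x, y) \<in> r \<and> x \<noteq> y\<close>.
  The constant \<open>regularCard\<close> says that every cofinal subset of \<open>r\<close> has full cardinality, but it
  holds vacuously for finite cardinals, hence \<open>Cinfinite\<close>.
\<close>

definition regular_cardinal :: "'a rel \<Rightarrow> bool" where
  "regular_cardinal r \<longleftrightarrow> Cinfinite r \<and> regularCard r"

definition set_ideal :: "'a set \<Rightarrow> 'a set set \<Rightarrow> bool" where
  "set_ideal D J \<longleftrightarrow>
     J \<subseteq> Pow D \<and> {} \<in> J \<and> D \<notin> J \<and>
     (\<forall>A\<in>J. \<forall>B. B \<subseteq> A \<longrightarrow> B \<in> J) \<and>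
     (\<forall>A\<in>J. \<forall>B\<in>J. A \<union> B \<in> J)"

definition positive :: "'a set \<Rightarrow> 'a set set \<Rightarrow> 'a set set" where
  "positive D J = {A. A \<subseteq> D \<and> A \<notin> J}"

text \<open>
  The quantifier ``for unboundedly many \<open>x < r\<close>'' is \<open>cofinal {x \<in> Field r. \<dots>} r\<close>. Finite sequences
  and tuples are lists, and the product of \<open>rs\<close> is \<open>listset (map Field rs)\<close>.
\<close>

primrec unboundedly_many :: "'a rel list \<Rightarrow> 'a list set \<Rightarrow> bool" where
  "unboundedly_many [] X \<longleftrightarrow> [] \<in> X"
| "unboundedly_many (r # rs) X \<longleftrightarrow>
     cofinal {x \<in> Field r. unboundedly_many rs {xs. x # xs \<in> X}} r"

definition Jbd :: "'a rel list \<Rightarrow> 'a list set set" where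
  "Jbd rs = {X. X \<subseteq> listset (map Field rs) \<and> \<not> unboundedly_many rs X}"

lemma positive_Jbd_iff:
  "X \<in> positive (listset (map Field rs)) (Jbd rs) \<longleftrightarrow>
     X \<subseteq> listset (map Field rs) \<and> unboundedly_many rs X"
  by (auto simp: positive_def Jbd_def)

lemma cofinal_mono: "cofinal A r \<Longrightarrow> A \<subseteq> B \<Longrightarrow> cofinal B r"
  unfolding cofinal_def by blast

lemma cofinal_Un:
  assumes "Well_order r" "cofinal (A \<union> B) r"
  shows "cofinal A r \<or> cofinal B r"
proof (rule ccontr)
  assume "\<not> ?thesis"
  then obtain a b where a: "a \<in> Field r" "\<forall>x\<in>A. a = x \<or> (a, x) \<notin> r"
    and b: "b \<in> Field r" "\<forall>x\<in>B. b = x \<or> (b, x) \<notin> r"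
    unfolding cofinal_def by blast
  have tot: "total_on (Field r) r" and tr: "trans r" and rf: "\<forall>x\<in>Field r. (x, x) \<in> r"
    and an: "antisym r"
    using assms(1) by (auto simp: well_order_on_def linear_order_on_def partial_order_on_def
        preorder_on_def refl_on_def)
  obtain c where c: "c \<in> Field r" "(a, c) \<in> r" "(b, c) \<in> r"
    using a(1) b(1) tot rf unfolding total_on_def by metis
  obtain x where x: "x \<in> A \<union> B" "c \<noteq> x" "(c, x) \<in> r"
    using assms(2) c(1) unfolding cofinal_def by blast
  have "(a, x) \<in> r" "(b, x) \<in> r" using c x tr by (meson transD)+
  then have "x = a \<or> x = b" using x a b by auto
  then show False using c x an unfolding antisym_def by blast
qed

lemma unboundedly_many_mono:
  "unboundedly_many rs X \<Longrightarrow> X \<subseteq> Y \<Longrightarrow> unboundedly_many rs Y"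
proof (induction rs arbitrary: X Y)
  case (Cons r rs)
  let ?S = "\<lambda>X. {x \<in> Field r. unboundedly_many rs {xs. x # xs \<in> X}}"
  have *: "{xs. x # xs \<in> X} \<subseteq> {xs. x # xs \<in> Y}" for x
    using Cons.prems(2) by (simp add: Collect_mono subset_iff)
  have "?S X \<subseteq> ?S Y"
    using Cons.IH[OF _ *] by (intro Collect_mono) simp
  then show ?case
    using Cons.prems(1) cofinal_mono[of "?S X" r "?S Y"] by simp
next
  case Nil
  then show ?case by (simp add: subsetD)
qed

lemma unboundedly_many_Un:
  assumes "\<forall>r\<in>set rs. regular_cardinal r" "unboundedly_many rs (X \<union> Y)"
  shows "unboundedly_many rs X \<or> unboundedly_many rs Y"
  using assms
proof (induction rs arbitrary: X Y)
  case (Cons r rs)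
  let ?S = "\<lambda>X. {x \<in> Field r. unboundedly_many rs {xs. x # xs \<in> X}}"
  have "?S (X \<union> Y) \<subseteq> ?S X \<union> ?S Y"
  proof
    fix x assume x: "x \<in> ?S (X \<union> Y)"
    have "{xs. x # xs \<in> X \<union> Y} = {xs. x # xs \<in> X} \<union> {xs. x # xs \<in> Y}" by blast
    then show "x \<in> ?S X \<union> ?S Y"
      using x Cons.IH[of "{xs. x # xs \<in> X}" "{xs. x # xs \<in> Y}"] Cons.prems(1) by auto
  qed
  then have "cofinal (?S X \<union> ?S Y) r"
    using Cons.prems(2) cofinal_mono by fastforce
  moreover have "Well_order r"
    using Cons.prems(1) by (auto simp: regular_cardinal_def card_order_on_def)
  ultimately show ?case
    using cofinal_Un by fastforce
qed auto

lemma unboundedly_many_full: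
  assumes "\<forall>r\<in>set rs. regular_cardinal r"
  shows "unboundedly_many rs (listset (map Field rs))"
  using assms
proof (induction rs)
  case (Cons r rs)
  have "{xs. x # xs \<in> listset (map Field (r # rs))} = listset (map Field rs)" if "x \<in> Field r" for x
    using that by (auto simp: set_Cons_def)
  moreover have "cofinal (Field r) r"
    using Cons.prems infinite_Card_order_limit[of r]
    by (auto simp: cofinal_def regular_cardinal_def cinfinite_def)
  ultimately show ?case
    using Cons by (simp cong: conj_cong)
qed auto

lemma unboundedly_many_empty:
  assumes "\<forall>r\<in>set rs. regular_cardinal r"
  shows "\<not> unboundedly_many rs {}"
  using assms
proof (induction rs)
  case (Cons r rs)
  have "Field r \<noteq> {}"
    using Cons.prems by (auto simp: regular_cardinal_def cinfinite_def)
  then show ?case using Cons by (auto simp: cofinal_def)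
qed auto

lemma set_ideal_Jbd:
  assumes "\<forall>r\<in>set rs. regular_cardinal r"
  shows "set_ideal (listset (map Field rs)) (Jbd rs)"
  unfolding set_ideal_def
proof (intro conjI ballI allI impI)
  show "listset (map Field rs) \<notin> Jbd rs"
    using unboundedly_many_full[OF assms] by (simp add: Jbd_def)
  show "{} \<in> Jbd rs"
    using unboundedly_many_empty[OF assms] by (simp add: Jbd_def)
  show "B \<in> Jbd rs" if "A \<in> Jbd rs" "B \<subseteq> A" for A B
    using that unboundedly_many_mono[of rs B A] by (auto simp: Jbd_def)
  show "A \<union> B \<in> Jbd rs" if "A \<in> Jbd rs" "B \<in> Jbd rs" for A B
    using that unboundedly_many_Un[OF assms, of A B] by (auto simp: Jbd_def)
qed (auto simp: Jbd_def)

text \<open>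
  In \<open>less_mod \<delta> R I\<close> the values at \<open>i < \<delta>\<close> are compared in the ordinal \<open>R i\<close>;
  \<open>(g i, f i) \<in> R i\<close> is \<open>f(i) \<ge> g(i)\<close>.
\<close>

definition less_mod ::
    "'d rel \<Rightarrow> ('d \<Rightarrow> 'b rel) \<Rightarrow> 'd set set \<Rightarrow> ('d \<Rightarrow> 'b) \<Rightarrow> ('d \<Rightarrow> 'b) \<Rightarrow> bool" where
  "less_mod \<delta> R I f g \<longleftrightarrow> {i \<in> Field \<delta>. (g i, f i) \<in> R i} \<in> I"

definition increasing_cofinal :: "'a rel \<Rightarrow> 'p set \<Rightarrow> ('p \<Rightarrow> 'p \<Rightarrow> bool) \<Rightarrow> ('a \<Rightarrow> 'p) \<Rightarrow> bool" where
  "increasing_cofinal r P lt s \<longleftrightarrow>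
     (\<forall>\<alpha>\<in>Field r. s \<alpha> \<in> P) \<and>
     (\<forall>\<alpha> \<beta>. (\<alpha>, \<beta>) \<in> r \<and> \<alpha> \<noteq> \<beta> \<longrightarrow> lt (s \<alpha>) (s \<beta>)) \<and>
     (\<forall>p\<in>P. \<exists>\<alpha>\<in>Field r. lt p (s \<alpha>) \<or> p = s \<alpha>)"

definition is_tcf :: "'a rel \<Rightarrow> 'p set \<Rightarrow> ('p \<Rightarrow> 'p \<Rightarrow> bool) \<Rightarrow> bool" where
  "is_tcf r P lt \<longleftrightarrow> regular_cardinal r \<and> (\<exists>s. increasing_cofinal r P lt s)"

end

theory Submission
  imports Defs
begin

text \<open>
  The proof is by induction on the length of the sequence, peeling off the outermost quantifier
  ``for unboundedly many \<open>x\<^sub>0 < \<lambda>\<^sub>0\<close>''.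

  Suppose the image of \<open>X\<close> at \<open>i\<close> is small for every \<open>i \<in> B\<close>. For such \<open>i\<close>, the set \<open>S i\<close> of first
  coordinates over which the image has a positive section is bounded in the first cardinal at \<open>i\<close>,
  and choosing bounds gives one function \<open>g\<close> in the product. The sequence of the \<open>f\<^bsub>0,x\<^esub>\<close> is
  increasing and cofinal modulo \<open>I\<close>, so \<open>f\<^bsub>0,x\<^esub>\<close> lies above \<open>g\<close> modulo \<open>I\<close> for all large \<open>x\<close>; since
  \<open>X\<close> is positive, one of these \<open>x\<close> has a positive section \<open>X\<^sub>x\<close> (\<open>noncofinal_sets_avoided\<close>).
  By the induction hypothesis the image of \<open>X\<^sub>x\<close> is positive at all \<open>i\<close> outside a set in \<open>I\<close>. This
  image is contained in the section of the image of \<open>X\<close> over \<open>f\<^bsub>0,x\<^esub>(i)\<close>, so \<open>f\<^bsub>0,x\<^esub>(i) \<in> S i\<close>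
  for those \<open>i \<in> B\<close>, whereas \<open>f\<^bsub>0,x\<^esub>(i) \<notin> S i\<close> for almost all \<open>i \<in> B\<close>. Hence \<open>B \<in> I\<close>.
\<close>

lemma set_ideal_subset: "set_ideal D I \<Longrightarrow> A \<in> I \<Longrightarrow> B \<subseteq> A \<Longrightarrow> B \<in> I"
  unfolding set_ideal_def by blast

lemma set_ideal_Un: "set_ideal D I \<Longrightarrow> A \<in> I \<Longrightarrow> B \<in> I \<Longrightarrow> A \<union> B \<in> I"
  unfolding set_ideal_def by blast

lemma linear_orderD:
  assumes "Linear_order r"
  shows linear_order_transD: "(a, b) \<in> r \<Longrightarrow> (b, c) \<in> r \<Longrightarrow> (a, c) \<in> r"
    and linear_order_linear: "a \<in> Field r \<Longrightarrow> b \<in> Field r \<Longrightarrow> (a, b) \<in> r \<or> (b, a) \<in> r"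
proof -
  have "trans r" "refl_on (Field r) r" "total_on (Field r) r"
    using assms by (auto simp: linear_order_on_def partial_order_on_def preorder_on_def)
  then show "(a, b) \<in> r \<Longrightarrow> (b, c) \<in> r \<Longrightarrow> (a, c) \<in> r"
    and "a \<in> Field r \<Longrightarrow> b \<in> Field r \<Longrightarrow> (a, b) \<in> r \<or> (b, a) \<in> r"
    by (blast dest: transD, metis refl_onD total_on_def)
qed

lemma less_mod_trans:
  assumes I: "set_ideal (Field \<delta>) I"
    and lin: "\<forall>i\<in>Field \<delta>. Linear_order (R i)"
    and P: "p \<in> (\<Pi>\<^sub>E i\<in>Field \<delta>. Field (R i))" "q \<in> (\<Pi>\<^sub>E i\<in>Field \<delta>. Field (R i))"
    and pq: "less_mod \<delta> R I p q" and qr: "less_mod \<delta> R I q r"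
  shows "less_mod \<delta> R I p r"
proof -
  have "{i \<in> Field \<delta>. (r i, p i) \<in> R i}
      \<subseteq> {i \<in> Field \<delta>. (q i, p i) \<in> R i} \<union> {i \<in> Field \<delta>. (r i, q i) \<in> R i}"
  proof
    fix i assume "i \<in> {i \<in> Field \<delta>. (r i, p i) \<in> R i}"
    then have i: "i \<in> Field \<delta>" and rp: "(r i, p i) \<in> R i" by auto
    have L: "Linear_order (R i)" and "p i \<in> Field (R i)" "q i \<in> Field (R i)"
      using i lin P by auto
    then have "(q i, p i) \<in> R i \<or> (p i, q i) \<in> R i"
      by (blast dest: linear_order_linear)
    then show "i \<in> {i \<in> Field \<delta>. (q i, p i) \<in> R i} \<union> {i \<in> Field \<delta>. (r i, q i) \<in> R i}"
      using i rp linear_order_transD[OF L] by blast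
  qed
  then show ?thesis
    using set_ideal_subset[OF I set_ideal_Un[OF I]] pq qr unfolding less_mod_def by blast
qed

text \<open>
  The cofinality of the sequence only gives some index \<open>\<alpha>\<close> with \<open>p\<close> below or equal to \<open>s \<alpha>\<close>;
  moving on to an index of \<open>A\<close> strictly above \<open>\<alpha>\<close> makes the inequality strict.
\<close>

lemma increasing_cofinal_exceeds:
  assumes s: "increasing_cofinal r P lt s"
    and A: "cofinal A r" and p: "p \<in> P"
    and trans: "\<And>q u. q \<in> P \<Longrightarrow> lt p q \<Longrightarrow> lt q u \<Longrightarrow> lt p u"
  shows "\<exists>x\<in>A. lt p (s x)"
proof -
  obtain \<alpha> where \<alpha>: "\<alpha> \<in> Field r" "lt p (s \<alpha>) \<or> p = s \<alpha>"
    using s p unfolding increasing_cofinal_def by blast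
  obtain x where x: "x \<in> A" "\<alpha> \<noteq> x" "(\<alpha>, x) \<in> r"
    using A \<alpha>(1) unfolding cofinal_def by blast
  have "lt (s \<alpha>) (s x)" "s \<alpha> \<in> P"
    using s x \<alpha>(1) unfolding increasing_cofinal_def by blast+
  then show ?thesis
    using x(1) \<alpha>(2) trans by blast
qed

text \<open>
  A function bounding every \<open>S i\<close> is overtaken modulo \<open>I\<close> by some \<open>s x\<close> with \<open>x \<in> A\<close>, and wherever
  it is overtaken, \<open>s x i\<close> lies outside \<open>S i\<close>.
\<close>

lemma noncofinal_sets_avoided:
  assumes I: "set_ideal (Field \<delta>) I"
    and lin: "\<forall>i\<in>Field \<delta>. Linear_order (R i) \<and> Field (R i) \<noteq> {}"
    and s: "increasing_cofinal r (\<Pi>\<^sub>E i\<in>Field \<delta>. Field (R i)) (less_mod \<delta> R I) s"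
    and A: "cofinal A r" and B: "B \<subseteq> Field \<delta>"
    and S: "\<And>i. i \<in> B \<Longrightarrow> S i \<subseteq> Field (R i) \<and> \<not> cofinal (S i) (R i)"
  shows "\<exists>x\<in>A. {i \<in> B. s x i \<in> S i} \<in> I"
proof -
  have bounded: "\<forall>i\<in>Field \<delta>. \<exists>b. b \<in> Field (R i) \<and> (i \<in> B \<longrightarrow> (\<forall>y\<in>S i. (y, b) \<in> R i))"
  proof
    fix i assume i: "i \<in> Field \<delta>"
    then have L: "Linear_order (R i)" using lin by blast
    show "\<exists>b. b \<in> Field (R i) \<and> (i \<in> B \<longrightarrow> (\<forall>y\<in>S i. (y, b) \<in> R i))"
    proof (cases "i \<in> B")
      case True
      then obtain b where b: "b \<in> Field (R i)" "\<forall>y\<in>S i. b = y \<or> (b, y) \<notin> R i"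
        using S[OF True] unfolding cofinal_def by blast
      have "\<forall>y\<in>S i. (y, b) \<in> R i"
      proof
        fix y assume y: "y \<in> S i"
        then have "y \<in> Field (R i)" using S[OF True] by auto
        then show "(y, b) \<in> R i"
          using b y linear_order_linear[OF L, of b y] by auto
      qed
      then show ?thesis using b(1) by blast
    next
      case False
      then show ?thesis using i lin by (simp add: ex_in_conv)
    qed
  qed
  obtain b
    where b: "\<forall>i\<in>Field \<delta>. b i \<in> Field (R i) \<and> (i \<in> B \<longrightarrow> (\<forall>y\<in>S i. (y, b i) \<in> R i))"
    using bchoice[OF bounded] ..
  define g where "g = restrict b (Field \<delta>)"
  have g: "g \<in> (\<Pi>\<^sub>E i\<in>Field \<delta>. Field (R i))"
    using b by (auto simp: g_def)
  obtain x where x: "x \<in> A" "less_mod \<delta> R I g (s x)"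
  proof -
    have "\<forall>i\<in>Field \<delta>. Linear_order (R i)" using lin by blast
    then have "\<exists>x\<in>A. less_mod \<delta> R I g (s x)"
      by (intro increasing_cofinal_exceeds[OF s A g]) (rule less_mod_trans[OF I _ g])
    then show ?thesis using that by blast
  qed
  have "{i \<in> B. s x i \<in> S i} \<subseteq> {i \<in> Field \<delta>. (s x i, g i) \<in> R i}"
    using b B by (auto simp: g_def)
  then show ?thesis
    using x set_ideal_subset[OF I] unfolding less_mod_def by blast
qed

text \<open>
  This form is stable under removing the first cardinal: the tails of the \<open>M i\<close>, the shifted
  families \<open>f (Suc l)\<close> and a section of \<open>X\<close> again satisfy the assumptions. The induction starts at
  the empty sequence, where \<open>X\<close> is positive iff it contains the empty tuple.
\<close>

lemma image_unboundedly_many: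
  assumes I: "set_ideal (Field \<delta>) I"
    and "\<forall>i\<in>Field \<delta>. length (M i) = length \<Lambda>"
    and "\<forall>l<length \<Lambda>. \<forall>i\<in>Field \<delta>. Linear_order (M i ! l) \<and> Field (M i ! l) \<noteq> {}"
    and "\<forall>l<length \<Lambda>. increasing_cofinal (\<Lambda> ! l) (\<Pi>\<^sub>E i\<in>Field \<delta>. Field (M i ! l))
            (less_mod \<delta> (\<lambda>i. M i ! l) I) (f l)"
    and "unboundedly_many \<Lambda> X"
  shows "{i \<in> Field \<delta>. \<not> unboundedly_many (M i)
            ((\<lambda>\<alpha>. map (\<lambda>l. f l (\<alpha> ! l) i) [0..<length \<Lambda>]) ` X)} \<in> I"
  using assms(2-)
proof (induction \<Lambda> arbitrary: M f X)
  case Nil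
  then have "{i \<in> Field \<delta>. \<not> unboundedly_many (M i)
            ((\<lambda>\<alpha>. map (\<lambda>l. f l (\<alpha> ! l) i) [0..<0]) ` X)} = {}"
    by auto
  moreover have "{} \<in> I" using I by (simp add: set_ideal_def)
  ultimately show ?case by (simp only: list.size)
next
  case (Cons r \<Lambda>)
  define G where "G i \<alpha> = map (\<lambda>l. f l (\<alpha> ! l) i) [0..<length (r # \<Lambda>)]" for i \<alpha>
  define H where "H i \<beta> = map (\<lambda>l. f (Suc l) (\<beta> ! l) i) [0..<length \<Lambda>]" for i \<beta>
  have G_Cons: "G i (x # \<beta>) = f 0 x i # H i \<beta>" for i x \<beta>
    unfolding G_def H_def by (simp add: map_upt_Suc del: upt_Suc)
  have M: "M i = (M i ! 0) # tl (M i)" if "i \<in> Field \<delta>" for i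
    using Cons.prems(1) that by (cases "M i") auto
  have tl_nth: "tl (M i) ! l = M i ! Suc l" if "i \<in> Field \<delta>" for i l
    by (subst (2) M[OF that]) simp
  define A where "A = {x \<in> Field r. unboundedly_many \<Lambda> {\<beta>. x # \<beta> \<in> X}}"
  define S where "S i = {y \<in> Field (M i ! 0). unboundedly_many (tl (M i)) {\<gamma>. y # \<gamma> \<in> G i ` X}}"
    for i
  define B where "B = {i \<in> Field \<delta>. \<not> unboundedly_many (M i) (G i ` X)}"
  have noncof: "S i \<subseteq> Field (M i ! 0) \<and> \<not> cofinal (S i) (M i ! 0)" if "i \<in> B" for i
  proof -
    have "i \<in> Field \<delta>" "\<not> unboundedly_many (M i) (G i ` X)" using that by (auto simp: B_def)
    then have "\<not> unboundedly_many ((M i ! 0) # tl (M i)) (G i ` X)" by (simp flip: M)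
    then show ?thesis by (auto simp: S_def)
  qed
  have head: "increasing_cofinal r (\<Pi>\<^sub>E i\<in>Field \<delta>. Field (M i ! 0)) (less_mod \<delta> (\<lambda>i. M i ! 0) I) (f 0)"
    using Cons.prems(3) by fastforce
  have "cofinal A r" using Cons.prems(4) by (simp add: A_def)
  moreover have "B \<subseteq> Field \<delta>" by (auto simp: B_def)
  moreover have "\<forall>i\<in>Field \<delta>. Linear_order (M i ! 0) \<and> Field (M i ! 0) \<noteq> {}"
    using Cons.prems(2) by simp
  ultimately obtain x where x: "x \<in> A" and avoid: "{i \<in> B. f 0 x i \<in> S i} \<in> I"
    using noncofinal_sets_avoided[OF I _ head _ _ noncof] by blast
  define C where "C = {i \<in> Field \<delta>. \<not> unboundedly_many (tl (M i)) (H i ` {\<beta>. x # \<beta> \<in> X})}"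
  have tl_cofinal: "\<forall>l<length \<Lambda>. increasing_cofinal (\<Lambda> ! l) (\<Pi>\<^sub>E i\<in>Field \<delta>. Field (tl (M i) ! l))
      (less_mod \<delta> (\<lambda>i. tl (M i) ! l) I) (f (Suc l))"
  proof (intro allI impI)
    fix l assume l: "l < length \<Lambda>"
    have "(\<Pi>\<^sub>E i\<in>Field \<delta>. Field (tl (M i) ! l)) = (\<Pi>\<^sub>E i\<in>Field \<delta>. Field (M i ! Suc l))"
      using tl_nth by (simp cong: PiE_cong)
    moreover have "less_mod \<delta> (\<lambda>i. tl (M i) ! l) I = less_mod \<delta> (\<lambda>i. M i ! Suc l) I"
      using tl_nth by (simp add: less_mod_def fun_eq_iff cong: conj_cong)
    ultimately show "increasing_cofinal (\<Lambda> ! l) (\<Pi>\<^sub>E i\<in>Field \<delta>. Field (tl (M i) ! l))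
        (less_mod \<delta> (\<lambda>i. tl (M i) ! l) I) (f (Suc l))"
      using Cons.prems(3) l by fastforce
  qed
  have "C \<in> I"
    unfolding C_def H_def
    by (rule Cons.IH) (use Cons.prems(1,2) tl_cofinal x tl_nth in \<open>auto simp: A_def\<close>)
  have "B \<subseteq> {i \<in> B. f 0 x i \<in> S i} \<union> C"
  proof
    fix i assume iB: "i \<in> B"
    then have i: "i \<in> Field \<delta>" by (simp add: B_def)
    have "f 0 x \<in> (\<Pi>\<^sub>E i\<in>Field \<delta>. Field (M i ! 0))"
      using head x unfolding increasing_cofinal_def A_def by blast
    then have fx: "f 0 x i \<in> Field (M i ! 0)" using i by auto
    have "H i ` {\<beta>. x # \<beta> \<in> X} \<subseteq> {\<gamma>. f 0 x i # \<gamma> \<in> G i ` X}"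
      by (auto simp: G_Cons[symmetric])
    then have "f 0 x i \<in> S i" if "i \<notin> C"
      using that i fx unboundedly_many_mono by (auto simp: C_def S_def)
    then show "i \<in> {i \<in> B. f 0 x i \<in> S i} \<union> C" using iB by blast
  qed
  then have "B \<in> I"
    using set_ideal_subset[OF I set_ideal_Un[OF I avoid \<open>C \<in> I\<close>]] by blast
  then show ?case unfolding B_def G_def .
qed

theorem mainTheorem5:
  fixes n :: nat
    and \<delta> :: "'d rel"
    and I :: "'d set set"
    and \<Lambda> :: "'a rel list"
    and M :: "'d \<Rightarrow> 'b rel list"
    and f :: "nat \<Rightarrow> 'a \<Rightarrow> 'd \<Rightarrow> 'b"
    and F :: "'a list \<Rightarrow> 'd \<Rightarrow> 'b list"
    and X :: "'a list set"
  assumes "1 \<le> n"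
    and "Well_order \<delta>"
    and "length \<Lambda> = n" and "\<forall>i\<in>Field \<delta>. length (M i) = n"
    and "set_ideal (Field \<delta>) I"
    and "\<forall>l<n. is_tcf (\<Lambda> ! l) (\<Pi>\<^sub>E i\<in>Field \<delta>. Field (M i ! l)) (less_mod \<delta> (\<lambda>i. M i ! l) I)"
    and "\<forall>l<n. increasing_cofinal (\<Lambda> ! l) (\<Pi>\<^sub>E i\<in>Field \<delta>. Field (M i ! l))
            (less_mod \<delta> (\<lambda>i. M i ! l) I) (f l)"
    and "\<forall>l<n. \<forall>i\<in>Field \<delta>. (\<delta>, M i ! l) \<in> ordLess \<and> regular_cardinal (M i ! l)"
    and "\<forall>\<alpha>\<in>listset (map Field \<Lambda>). \<forall>i\<in>Field \<delta>. F \<alpha> i = map (\<lambda>l. f l (\<alpha> ! l) i) [0..<n]"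
    and "X \<in> positive (listset (map Field \<Lambda>)) (Jbd \<Lambda>)"
  shows "{i \<in> Field \<delta>. {F \<alpha> i | \<alpha>. \<alpha> \<in> X} \<in> Jbd (M i)} \<in> I"
proof -
  have X: "X \<subseteq> listset (map Field \<Lambda>)" "unboundedly_many \<Lambda> X"
    using assms(10) by (simp_all add: positive_Jbd_iff)
  have lin: "Linear_order (M i ! l) \<and> Field (M i ! l) \<noteq> {}" if "l < n" "i \<in> Field \<delta>" for i l
  proof -
    have "regular_cardinal (M i ! l)" using assms(8) that by blast
    then show ?thesis
      by (auto simp: regular_cardinal_def card_order_on_def well_order_on_def cinfinite_def)
  qed
  have small: "{i \<in> Field \<delta>. \<not> unboundedly_many (M i)
      ((\<lambda>\<alpha>. map (\<lambda>l. f l (\<alpha> ! l) i) [0..<length \<Lambda>]) ` X)} \<in> I"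
    using image_unboundedly_many[OF assms(5), of M \<Lambda> f X] assms(3,4,7) lin X(2) by auto
  have "{F \<alpha> i | \<alpha>. \<alpha> \<in> X} = (\<lambda>\<alpha>. map (\<lambda>l. f l (\<alpha> ! l) i) [0..<length \<Lambda>]) ` X"
    if "i \<in> Field \<delta>" for i
  proof -
    have "F \<alpha> i = map (\<lambda>l. f l (\<alpha> ! l) i) [0..<length \<Lambda>]" if "\<alpha> \<in> X" for \<alpha>
      using assms(3,9) X(1) \<open>i \<in> Field \<delta>\<close> that by blast
    then show ?thesis by (simp add: Setcompr_eq_image cong: image_cong_simp)
  qed
  then have "{i \<in> Field \<delta>. {F \<alpha> i | \<alpha>. \<alpha> \<in> X} \<in> Jbd (M i)}
      \<subseteq> {i \<in> Field \<delta>. \<not> unboundedly_many (M i)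
          ((\<lambda>\<alpha>. map (\<lambda>l. f l (\<alpha> ! l) i) [0..<length \<Lambda>]) ` X)}"
    by (auto simp: Jbd_def)
  then show ?thesis
    by (rule set_ideal_subset[OF assms(5) small])
qed

end
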